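(* With the notation below, $\hat I=(\hat I\cap\hat B)(\hat I\cap\hat B')$, and $(\hat I\cap\hat B)\cap(\hat I\cap\hat B')=\hat H$.
   Context: Let $F$ be a non-archimedean local field with ring of integers $\mathfrak{o}$, uniformizer $\varpi$, and finite residue field of cardinality $q$. $X=X_{PGL_2(F)}$ is the Bruhat–Tits tree of $PGL_2(F)$: vertices are homothety classes of $\mathfrak{o}$-lattices in $F^2$, with $[L],[L']$ adjacent iff there are representatives with $\varpi L\subsetneq L'\subsetneq L$; it is $(q+1)$-regular. $d$ is the path-length distance; $\mathrm{Aut}(X)$ is the group of distance-preserving bijections of the vertex set with the topology of pointwise convergence, and $PGL_2(F)\hookrightarrow\mathrm{Aut}(X)$ via the linear action on lattices. For an edge $\eta=\{y_1,y_2\}$ and $e\ge1$, $B(\eta,e)=\{y:\min(d(y,y_1),d(y,y_2))\le e\}$, and $\hat G=\hat G^{(e)}=\{g\in\mathrm{Aut}(X):\forall\eta\ \exists g'\in PGL_2(F),\ g|_{B(\eta,e)}=g'|_{B(\eta,e)}\}$ for a fixed $e\ge1$. Ends are equivalence classes of infinite paths (agreeing after an index shift from some point on). Fix a doubly infinite path $(x_n)_{n\in\mathbb{Z}}$; let $\omega$ be the end of $(x_n)_{n\ge0}$ and $\omega'$ the end of $(x_{-n})_{n\ge0}$. Set $\hat B=\{g\in\hat G: g(\omega)=\omega\}$, $\hat B'=\{g\in\hat G: g(\omega')=\omega'\}$, $\hat N=\{b\in\hat B: b(x_i)=x_i\text{ for some }i\in\mathbb{Z}\}$, $\hat H=\{n\in\hat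 N: n(x_k)=x_k\ \forall k\in\mathbb{Z}\}$, and $\hat I=\{g\in\hat G: g(x_0)=x_0,\ g(x_1)=x_1\}$. *)

theory Defs
  imports Main
begin

text \<open>A normalized discrete valuation on a field, given on nonzero elements
  (its value at 0 is irrelevant; 0 is treated as having valuation +infinity).\<close>
definition dval_field :: "('a::field \<Rightarrow> int) \<Rightarrow> bool" where
  "dval_field v \<longleftrightarrow>
     (\<forall>x y. x \<noteq> 0 \<longrightarrow> y \<noteq> 0 \<longrightarrow> v (x * y) = v x + v y) \<and>
     (\<forall>x y. x \<noteq> 0 \<longrightarrow> y \<noteq> 0 \<longrightarrow> x + y \<noteq> 0 \<longrightarrow> v (x + y) \<ge> min (v x) (v y)) \<and>
     (\<forall>n. \<exists>x. x \<noteq> 0 \<and> v x = n)"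

definition intring :: "('a::field \<Rightarrow> int) \<Rightarrow> 'a set" where
  "intring v = {x. x = 0 \<or> 0 \<le> v x}"

definition maxideal :: "('a::field \<Rightarrow> int) \<Rightarrow> 'a set" where
  "maxideal v = {x. x = 0 \<or> 1 \<le> v x}"

definition residue_rel :: "('a::field \<Rightarrow> int) \<Rightarrow> ('a \<times> 'a) set" where
  "residue_rel v = {(a, b). a \<in> intring v \<and> b \<in> intring v \<and> a - b \<in> maxideal v}"

definition complete_dval :: "('a::field \<Rightarrow> int) \<Rightarrow> bool" where
  "complete_dval v \<longleftrightarrow>
     (\<forall>s :: nat \<Rightarrow> 'a.
        (\<forall>k::int. \<exists>N. \<forall>m\<ge>N. \<forall>n\<ge>N. s m - s n = 0 \<or> v (s m - s n) \<ge> k) \<longrightarrow>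
        (\<exists>l. \<forall>k::int. \<exists>N. \<forall>n\<ge>N. s n - l = 0 \<or> v (s n - l) \<ge> k))"

definition nonarch_local_field :: "('a::field \<Rightarrow> int) \<Rightarrow> bool" where
  "nonarch_local_field v \<longleftrightarrow>
     dval_field v \<and> complete_dval v \<and> finite (intring v // residue_rel v)"

definition unif :: "('a::field \<Rightarrow> int) \<Rightarrow> 'a" where
  "unif v = (SOME p. p \<noteq> 0 \<and> v p = 1)"

type_synonym 'a vertex = "('a \<times> 'a) set set"

definition olattice :: "('a::field \<Rightarrow> int) \<Rightarrow> ('a \<times> 'a) set \<Rightarrow> bool" where
  "olattice v L \<longleftrightarrow> (\<exists>u w. fst u * snd w - snd u * fst w \<noteq> 0 \<and>
      L = {(a * fst u + b * fst w, a * snd u + b * snd w) | a b. a \<in> intring v \<and> b \<in> intring v})"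

definition scale :: "'a::field \<Rightarrow> ('a \<times> 'a) set \<Rightarrow> ('a \<times> 'a) set" where
  "scale c L = (\<lambda>p. (c * fst p, c * snd p)) ` L"

definition hclass :: "('a::field \<times> 'a) set \<Rightarrow> 'a vertex" where
  "hclass L = {scale c L | c. c \<noteq> 0}"

definition vertices :: "('a::field \<Rightarrow> int) \<Rightarrow> 'a vertex set" where
  "vertices v = {hclass L | L. olattice v L}"

definition adj :: "('a::field \<Rightarrow> int) \<Rightarrow> 'a vertex \<Rightarrow> 'a vertex \<Rightarrow> bool" where
  "adj v X Y \<longleftrightarrow> X \<in> vertices v \<and> Y \<in> vertices v \<and>
     (\<exists>L\<in>X. \<exists>L'\<in>Y. scale (unif v) L \<subset> L' \<and> L' \<subset> L)"

text \<open>Path-length distance (the tree is connected).\<close>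
definition tdist :: "('a::field \<Rightarrow> int) \<Rightarrow> 'a vertex \<Rightarrow> 'a vertex \<Rightarrow> nat" where
  "tdist v X Y = (LEAST n. \<exists>p :: nat \<Rightarrow> 'a vertex. p 0 = X \<and> p n = Y \<and>
                     (\<forall>i<n. adj v (p i) (p (Suc i))))"

definition ball_edge :: "('a::field \<Rightarrow> int) \<Rightarrow> 'a vertex \<Rightarrow> 'a vertex \<Rightarrow> nat \<Rightarrow> 'a vertex set" where
  "ball_edge v y1 y2 e = {y \<in> vertices v. min (tdist v y y1) (tdist v y y2) \<le> e}"

definition aut :: "('a::field \<Rightarrow> int) \<Rightarrow> ('a vertex \<Rightarrow> 'a vertex) \<Rightarrow> bool" where
  "aut v g \<longleftrightarrow> bij_betw g (vertices v) (vertices v) \<and>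
     (\<forall>X\<in>vertices v. \<forall>Y\<in>vertices v. tdist v (g X) (g Y) = tdist v X Y) \<and>
     (\<forall>X. X \<notin> vertices v \<longrightarrow> g X = X)"

type_synonym 'a mat2 = "'a \<times> 'a \<times> 'a \<times> 'a"

definition mat_inv :: "'a::field mat2 \<Rightarrow> bool" where
  "mat_inv M = (case M of (a, b, c, d) \<Rightarrow> a * d - b * c \<noteq> 0)"

definition matact :: "'a::field mat2 \<Rightarrow> 'a \<times> 'a \<Rightarrow> 'a \<times> 'a" where
  "matact M p = (case M of (a, b, c, d) \<Rightarrow> (a * fst p + b * snd p, c * fst p + d * snd p))"

definition pgl_act :: "('a::field \<Rightarrow> int) \<Rightarrow> 'a mat2 \<Rightarrow> 'a vertex \<Rightarrow> 'a vertex" where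
  "pgl_act v M X = (if X \<in> vertices v then {matact M ` L | L. L \<in> X} else X)"

definition Ghat :: "('a::field \<Rightarrow> int) \<Rightarrow> nat \<Rightarrow> ('a vertex \<Rightarrow> 'a vertex) set" where
  "Ghat v e = {g. aut v g \<and>
     (\<forall>y1 y2. adj v y1 y2 \<longrightarrow>
        (\<exists>M. mat_inv M \<and> (\<forall>y\<in>ball_edge v y1 y2 e. g y = pgl_act v M y)))}"

definition dpath :: "('a::field \<Rightarrow> int) \<Rightarrow> (int \<Rightarrow> 'a vertex) \<Rightarrow> bool" where
  "dpath v x \<longleftrightarrow> (\<forall>n. adj v (x n) (x (n + 1))) \<and> (\<forall>n. x (n - 1) \<noteq> x (n + 1))"

definition fixes_end_fwd :: "('a vertex \<Rightarrow> 'a vertex) \<Rightarrow> (int \<Rightarrow> 'a vertex) \<Rightarrow> bool" where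
  "fixes_end_fwd g x \<longleftrightarrow> (\<exists>k::int. \<exists>N::int. \<forall>n\<ge>N. g (x n) = x (n + k))"

definition fixes_end_bwd :: "('a vertex \<Rightarrow> 'a vertex) \<Rightarrow> (int \<Rightarrow> 'a vertex) \<Rightarrow> bool" where
  "fixes_end_bwd g x \<longleftrightarrow> (\<exists>k::int. \<exists>N::int. \<forall>n\<ge>N. g (x (- n)) = x (- (n + k)))"

definition Bhat where
  "Bhat v e x = {g \<in> Ghat v e. fixes_end_fwd g x}"

definition Bhat' where
  "Bhat' v e x = {g \<in> Ghat v e. fixes_end_bwd g x}"

definition Nhat where
  "Nhat v e x = {b \<in> Bhat v e x. \<exists>i. b (x i) = x i}"

definition Hhat where
  "Hhat v e x = {n \<in> Nhat v e x. \<forall>k. n (x k) = x k}"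

definition Ihat where
  "Ihat v e x = {g \<in> Ghat v e. g (x 0) = x 0 \<and> g (x 1) = x 1}"

definition setprod :: "('b \<Rightarrow> 'b) set \<Rightarrow> ('b \<Rightarrow> 'b) set \<Rightarrow> ('b \<Rightarrow> 'b) set" where
  "setprod A B = {g \<circ> h | g h. g \<in> A \<and> h \<in> B}"

end

theory Submission
  imports Defs
begin

text \<open>A vertex of the tree is a ball of the field, the neighbours of a ball being its parent and its
  maximal subballs. For \<open>g\<close> in the Iwahori subgroup, \<open>n \<mapsto> g\<^sup>-\<^sup>1(x\<^sub>n)\<close>, \<open>n \<ge> 0\<close>, is a ray starting with
  the edge \<open>x\<^sub>0, x\<^sub>1\<close>. Some \<open>u\<close> in \<open>PGL\<^sub>2(F)\<close> (a translation, in suitable coordinates) fixes \<open>x\<^sub>n\<close>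
  for \<open>n \<le> 1\<close> and moves this ray to \<open>(x\<^sub>n)\<close>; then \<open>g u\<^sup>-\<^sup>1\<close> fixes \<open>x\<^sub>n\<close> for \<open>n \<ge> 0\<close> and
  \<open>g = (g u\<^sup>-\<^sup>1) u\<close> is the required factorization.\<close>

section \<open>Homothety classes\<close>

lemma scale_scale: "scale a (scale b L) = scale (a * b) L"
  by (auto simp: scale_def image_image mult.assoc)

lemma scale_one [simp]: "scale 1 L = L"
  by (auto simp: scale_def)

lemma mem_scale_iff:
  assumes "c \<noteq> 0"
  shows "(p, q) \<in> scale c L \<longleftrightarrow> (p / c, q / c) \<in> L"
proof
  assume "(p, q) \<in> scale c L"
  then show "(p / c, q / c) \<in> L" using assms by (auto simp: scale_def)
next
  assume "(p / c, q / c) \<in> L"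
  then have "(\<lambda>p. (c * fst p, c * snd p)) (p / c, q / c) \<in> scale c L"
    unfolding scale_def by (rule imageI)
  then show "(p, q) \<in> scale c L" using assms by simp
qed

lemma mem_hclass_iff: "L' \<in> hclass L \<longleftrightarrow> (\<exists>c. c \<noteq> 0 \<and> L' = scale c L)"
  by (auto simp: hclass_def)

lemma hclass_scale:
  assumes "c \<noteq> 0"
  shows "hclass (scale c L) = hclass L"
proof -
  have "\<exists>d. d \<noteq> 0 \<and> scale a L = scale (d * c) L" if "a \<noteq> 0" for a
    using that assms by (intro exI[of _ "a / c"]) simp
  then show ?thesis
    using assms by (fastforce simp: hclass_def scale_scale)
qed

lemma hclass_eq_iff: "hclass L = hclass L' \<longleftrightarrow> (\<exists>c. c \<noteq> 0 \<and> L' = scale c L)"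
proof
  assume "hclass L = hclass L'"
  moreover have "L' \<in> hclass L'"
    using mem_hclass_iff[of L' L'] by (metis scale_one zero_neq_one)
  ultimately have "L' \<in> hclass L" by (simp only:)
  then show "\<exists>c. c \<noteq> 0 \<and> L' = scale c L" by (simp only: mem_hclass_iff)
qed (auto simp: hclass_scale)

section \<open>The action of invertible matrices on lattices and vertices\<close>

lemma matact_scale: "matact M ` scale c L = scale c (matact M ` L)"
  by (cases M) (auto simp: scale_def matact_def image_image algebra_simps)

lemma matact_hclass: "{matact M ` L' | L'. L' \<in> hclass L} = hclass (matact M ` L)"
proof -
  have "{matact M ` L' | L'. L' \<in> hclass L} = {matact M ` scale c L | c. c \<noteq> 0}"
    by (auto simp: hclass_def)
  then show ?thesis by (simp add: hclass_def matact_scale)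
qed

fun mat_mult :: "'a::field mat2 \<Rightarrow> 'a mat2 \<Rightarrow> 'a mat2" where
  "mat_mult (a, b, c, d) (a', b', c', d') =
     (a * a' + b * c', a * b' + b * d', c * a' + d * c', c * b' + d * d')"

fun mat_inverse :: "'a::field mat2 \<Rightarrow> 'a mat2" where
  "mat_inverse (a, b, c, d) = (let e = a * d - b * c in (d / e, - b / e, - c / e, a / e))"

lemma matact_mult: "matact (mat_mult M N) p = matact M (matact N p)"
  by (cases M; cases N) (simp add: matact_def algebra_simps)

lemma mat_inv_mult:
  assumes "mat_inv M" "mat_inv N"
  shows "mat_inv (mat_mult M N)"
proof -
  obtain a b c d where M: "M = (a, b, c, d)" by (cases M)
  obtain a' b' c' d' where N: "N = (a', b', c', d')" by (cases N)
  have eq: "(a * a' + b * c') * (c * b' + d * d') - (a * b' + b * d') * (c * a' + d * c') =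
        (a * d - b * c) * (a' * d' - b' * c')"
    by (simp add: algebra_simps)
  have "(a * a' + b * c') * (c * b' + d * d') - (a * b' + b * d') * (c * a' + d * c') \<noteq> 0"
    unfolding eq using assms by (simp add: mat_inv_def M N)
  then show ?thesis using assms by (simp add: mat_inv_def M N)
qed

lemma mat_mult_inverse:
  assumes "mat_inv M"
  shows "mat_mult M (mat_inverse M) = (1, 0, 0, 1)" "mat_mult (mat_inverse M) M = (1, 0, 0, 1)"
proof -
  obtain a b c d where M: "M = (a, b, c, d)" by (cases M)
  have "a * d - b * c \<noteq> 0" using assms by (simp add: mat_inv_def M)
  then show "mat_mult M (mat_inverse M) = (1, 0, 0, 1)" "mat_mult (mat_inverse M) M = (1, 0, 0, 1)"
    by (auto simp: M Let_def divide_simps)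
qed

lemma matact_one [simp]: "matact (1, 0, 0, 1) p = p"
  by (simp add: matact_def)

lemma mat_inv_inverse:
  assumes "mat_inv M"
  shows "mat_inv (mat_inverse M)"
proof -
  obtain a b c d where M: "M = (a, b, c, d)" by (cases M)
  define e where "e = a * d - b * c"
  have "e \<noteq> 0" using assms by (simp add: mat_inv_def M e_def)
  moreover have eq: "d / e * (a / e) - (- b / e) * (- c / e) = e / (e * e)"
    by (simp add: e_def diff_divide_distrib mult.commute)
  ultimately have "d / e * (a / e) - (- b / e) * (- c / e) \<noteq> 0" unfolding eq by simp
  then show ?thesis by (simp add: M mat_inv_def Let_def flip: e_def)
qed

text \<open>With relation powers in place of explicit vertex sequences, distances can be handled by
  induction and connectedness by \<open>rtranclp\<close>.\<close>

lemma tdist_eq: "tdist v X Y = (LEAST n. (adj v ^^ n) X Y)"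
  by (simp add: tdist_def relpowp_fun_conv)

lemma olattice_matact:
  assumes "mat_inv M" "olattice v L"
  shows "olattice v (matact M ` L)"
proof -
  obtain a b c d where M: "M = (a, b, c, d)" by (cases M)
  obtain u w where uw: "fst u * snd w - snd u * fst w \<noteq> 0"
    and L: "L = {(a * fst u + b * fst w, a * snd u + b * snd w) | a b. a \<in> intring v \<and> b \<in> intring v}"
    using assms(2) by (auto simp: olattice_def)
  have "fst (matact M u) * snd (matact M w) - snd (matact M u) * fst (matact M w) =
      (a * d - b * c) * (fst u * snd w - snd u * fst w)"
    by (simp add: M matact_def algebra_simps)
  then have "fst (matact M u) * snd (matact M w) - snd (matact M u) * fst (matact M w) \<noteq> 0"
    using uw assms(1) by (simp add: mat_inv_def M)
  moreover have lin: "matact M (r * fst u + s * fst w, r * snd u + s * snd w) =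
      (r * fst (matact M u) + s * fst (matact M w), r * snd (matact M u) + s * snd (matact M w))" for r s
    by (simp add: M matact_def algebra_simps)
  have "matact M ` L = {(r * fst (matact M u) + s * fst (matact M w), r * snd (matact M u) + s * snd (matact M w))
      | r s. r \<in> intring v \<and> s \<in> intring v}" (is "_ = ?R")
  proof
    show "matact M ` L \<subseteq> ?R" unfolding L using lin by blast
    show "?R \<subseteq> matact M ` L"
    proof
      fix z assume "z \<in> ?R"
      then obtain r s where "r \<in> intring v" "s \<in> intring v"
        and "z = matact M (r * fst u + s * fst w, r * snd u + s * snd w)" by (auto simp: lin)
      then show "z \<in> matact M ` L" unfolding L by blast
    qed
  qed
  ultimately show ?thesis unfolding olattice_def by blast
qed

lemma pgl_act_hclass: "olattice v L \<Longrightarrow> pgl_act v M (hclass L) = hclass (matact M ` L)"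
  by (auto simp: pgl_act_def vertices_def matact_hclass)

lemma pgl_act_vertices:
  assumes "mat_inv M" "X \<in> vertices v"
  shows "pgl_act v M X \<in> vertices v"
proof -
  obtain L where L: "olattice v L" "X = hclass L" using assms(2) by (auto simp: vertices_def)
  then have "pgl_act v M X = hclass (matact M ` L)" by (simp add: pgl_act_hclass)
  then show ?thesis using olattice_matact[OF assms(1) L(1)] unfolding vertices_def by blast
qed

text \<open>Invertibility of \<open>N\<close> keeps the inner image a vertex, so that the outer
  action is again given by its effect on a lattice. Off the vertices both sides are
  \<open>X\<close>.\<close>

lemma pgl_act_mult:
  assumes "mat_inv N"
  shows "pgl_act v (mat_mult M N) X = pgl_act v M (pgl_act v N X)"
proof (cases "X \<in> vertices v")
  case True
  then obtain L where L: "olattice v L" "X = hclass L" by (auto simp: vertices_def)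
  then show ?thesis
    using olattice_matact[OF assms L(1)] by (simp add: pgl_act_hclass image_image matact_mult)
qed (simp add: pgl_act_def)

lemma pgl_act_one: "pgl_act v (1, 0, 0, 1) X = X"
proof (cases "X \<in> vertices v")
  case True
  then obtain L where L: "olattice v L" "X = hclass L" by (auto simp: vertices_def)
  then show ?thesis by (simp add: pgl_act_hclass)
qed (simp add: pgl_act_def)

lemma pgl_act_inverse:
  assumes "mat_inv M"
  shows "pgl_act v M (pgl_act v (mat_inverse M) X) = X" "pgl_act v (mat_inverse M) (pgl_act v M X) = X"
  using pgl_act_mult[OF assms, of v "mat_inverse M" X]
    pgl_act_mult[OF mat_inv_inverse[OF assms], of v M X] mat_mult_inverse[OF assms]
  by (simp_all add: pgl_act_one)

text \<open>Injectivity is what keeps the strict inclusions in \<open>adj\<close> strict under the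
  action.\<close>

lemma inj_matact:
  assumes "mat_inv M"
  shows "inj (matact M)"
  by (rule inj_on_inverseI[of _ "matact (mat_inverse M)"])
    (simp flip: matact_mult add: mat_mult_inverse[OF assms])

lemma adj_pgl_act:
  assumes "mat_inv M" "adj v X Y"
  shows "adj v (pgl_act v M X) (pgl_act v M Y)"
proof -
  have V: "X \<in> vertices v" "Y \<in> vertices v" using assms(2) by (auto simp: adj_def)
  obtain L L' where L: "L \<in> X" "L' \<in> Y" "scale (unif v) L \<subset> L'" "L' \<subset> L"
    using assms(2) by (auto simp: adj_def)
  have "matact M ` scale (unif v) L \<subset> matact M ` L'" "matact M ` L' \<subset> matact M ` L"
    using L(3,4) inj_matact[OF assms(1)] by (meson image_strict_mono inj_on_subset subset_UNIV)+
  moreover have "matact M ` L \<in> pgl_act v M X" "matact M ` L' \<in> pgl_act v M Y"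
    using L V by (auto simp: pgl_act_def)
  ultimately show ?thesis
    using pgl_act_vertices[OF assms(1)] V unfolding adj_def by (metis matact_scale)
qed

lemma relpowp_adj_pgl_act:
  assumes "mat_inv M"
  shows "(adj v ^^ n) X Y \<Longrightarrow> (adj v ^^ n) (pgl_act v M X) (pgl_act v M Y)"
  by (induction n arbitrary: Y) (auto intro: adj_pgl_act[OF assms] relcomppI)

text \<open>\<open>M\<close> and its inverse both preserve each power of \<open>adj\<close>, so the
  two \<open>LEAST\<close> expressions range over the same set of lengths.\<close>

lemma tdist_pgl_act:
  assumes "mat_inv M"
  shows "tdist v (pgl_act v M X) (pgl_act v M Y) = tdist v X Y"
proof -
  have "(adj v ^^ n) (pgl_act v M X) (pgl_act v M Y) \<longleftrightarrow> (adj v ^^ n) X Y" for n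
    using relpowp_adj_pgl_act[OF assms, of n v X Y]
      relpowp_adj_pgl_act[OF mat_inv_inverse[OF assms], of n v "pgl_act v M X" "pgl_act v M Y"]
    by (auto simp: pgl_act_inverse[OF assms])
  then show ?thesis by (simp add: tdist_eq)
qed

lemma aut_pgl_act:
  assumes "mat_inv M"
  shows "aut v (pgl_act v M)"
  unfolding aut_def
proof (intro conjI ballI allI impI)
  show "bij_betw (pgl_act v M) (vertices v) (vertices v)"
    by (rule bij_betw_byWitness[of _ "pgl_act v (mat_inverse M)"])
      (auto simp: pgl_act_inverse[OF assms] pgl_act_vertices assms mat_inv_inverse)
qed (simp_all add: tdist_pgl_act[OF assms], simp add: pgl_act_def)

lemma pgl_act_in_Ghat: "mat_inv M \<Longrightarrow> pgl_act v M \<in> Ghat v e"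
  unfolding Ghat_def by (blast intro: aut_pgl_act)

lemma aut_comp:
  assumes "aut v g" "aut v h"
  shows "aut v (g \<circ> h)"
proof -
  have "h X \<in> vertices v" if "X \<in> vertices v" for X
    using assms(2) that by (auto simp: aut_def bij_betw_def)
  then show ?thesis
    using assms by (auto simp: aut_def intro: bij_betw_trans)
qed

section \<open>Fractional ideals of a discretely valued field\<close>

locale valued_field =
  fixes v :: "'a::field \<Rightarrow> int"
  assumes dval: "dval_field v"
begin

text \<open>The n-th power of the maximal ideal, for any integer n. Zero is put in by hand because
  \<open>v 0\<close> is unconstrained.\<close>

definition frac_ideal :: "int \<Rightarrow> 'a set" where
  "frac_ideal n = {z. z = 0 \<or> n \<le> v z}"

lemma v_mult: "x \<noteq> 0 \<Longrightarrow> y \<noteq> 0 \<Longrightarrow> v (x * y) = v x + v y"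
  using dval by (simp add: dval_field_def)

lemma v_add: "x \<noteq> 0 \<Longrightarrow> y \<noteq> 0 \<Longrightarrow> x + y \<noteq> 0 \<Longrightarrow> min (v x) (v y) \<le> v (x + y)"
  using dval unfolding dval_field_def by blast

lemma v_surj: obtains x where "x \<noteq> 0" "v x = n"
  using dval unfolding dval_field_def by blast

lemma v_unif: "unif v \<noteq> 0" "v (unif v) = 1"
proof -
  have "\<exists>p. p \<noteq> 0 \<and> v p = 1" using v_surj by metis
  then have "unif v \<noteq> 0 \<and> v (unif v) = 1" unfolding unif_def by (rule someI_ex)
  then show "unif v \<noteq> 0" "v (unif v) = 1" by auto
qed

lemma v_one [simp]: "v 1 = 0"
  using v_mult[of 1 1] by simp

lemma v_minus [simp]: "v (- x) = v x"
proof (cases "x = 0")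
  case False
  have "v (-1) = 0" using v_mult[of "-1" "-1"] by simp
  then show ?thesis using v_mult[of "-1" x] False by simp
qed simp

lemma v_divide: "x \<noteq> 0 \<Longrightarrow> y \<noteq> 0 \<Longrightarrow> v (x / y) = v x - v y"
  using v_mult[of "x / y" y] by simp

lemma intring_eq: "intring v = frac_ideal 0"
  by (simp add: intring_def frac_ideal_def)

lemma frac_ideal_zero [simp]: "0 \<in> frac_ideal n"
  by (simp add: frac_ideal_def)

lemma frac_ideal_mono: "x \<in> frac_ideal n \<Longrightarrow> m \<le> n \<Longrightarrow> x \<in> frac_ideal m"
  by (auto simp: frac_ideal_def)

lemma frac_ideal_add: "x \<in> frac_ideal n \<Longrightarrow> y \<in> frac_ideal n \<Longrightarrow> x + y \<in> frac_ideal n"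
  using v_add[of x y] by (cases "x = 0"; cases "y = 0"; cases "x + y = 0") (auto simp: frac_ideal_def)

lemma frac_ideal_minus [simp]: "- x \<in> frac_ideal n \<longleftrightarrow> x \<in> frac_ideal n"
  by (simp add: frac_ideal_def)

lemma frac_ideal_diff: "x \<in> frac_ideal n \<Longrightarrow> y \<in> frac_ideal n \<Longrightarrow> x - y \<in> frac_ideal n"
  using frac_ideal_add[of x n "- y"] by simp

lemma frac_ideal_diff_commute: "x - y \<in> frac_ideal n \<longleftrightarrow> y - x \<in> frac_ideal n"
  by (metis frac_ideal_minus minus_diff_eq)

lemma frac_ideal_diff_trans:
  "x - y \<in> frac_ideal n \<Longrightarrow> y - z \<in> frac_ideal n \<Longrightarrow> x - z \<in> frac_ideal n"
  using frac_ideal_add[of "x - y" n "y - z"] by simp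

lemma frac_ideal_mult: "x \<in> frac_ideal m \<Longrightarrow> y \<in> frac_ideal n \<Longrightarrow> x * y \<in> frac_ideal (m + n)"
  by (cases "x = 0"; cases "y = 0") (auto simp: frac_ideal_def v_mult)

lemma frac_ideal_mult_iff: "c \<noteq> 0 \<Longrightarrow> c * x \<in> frac_ideal n \<longleftrightarrow> x \<in> frac_ideal (n - v c)"
  by (cases "x = 0") (auto simp: frac_ideal_def v_mult)

lemma frac_ideal_divide_iff: "c \<noteq> 0 \<Longrightarrow> x / c \<in> frac_ideal n \<longleftrightarrow> x \<in> frac_ideal (n + v c)"
  by (cases "x = 0") (auto simp: frac_ideal_def v_divide)

lemma mem_frac_ideal: "x \<noteq> 0 \<Longrightarrow> x \<in> frac_ideal n \<longleftrightarrow> n \<le> v x"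
  by (simp add: frac_ideal_def)

section \<open>Vertices as balls of the field\<close>

text \<open>The lattice spanned by \<open>(t, 1)\<close> and \<open>(\<varpi>\<^sup>n, 0)\<close>; its homothety class corresponds to
  the ball of radius \<open>n\<close> around \<open>t\<close> in the field.\<close>

definition Lat :: "int \<Rightarrow> 'a \<Rightarrow> ('a \<times> 'a) set" where
  "Lat n t = {(p, q). q \<in> frac_ideal 0 \<and> p - q * t \<in> frac_ideal n}"

definition ballv :: "int \<Rightarrow> 'a \<Rightarrow> 'a vertex" where
  "ballv n t = hclass (Lat n t)"

lemma mem_scale_Lat:
  assumes "c \<noteq> 0"
  shows "(p, q) \<in> scale c (Lat n t) \<longleftrightarrow> q \<in> frac_ideal (v c) \<and> p - q * t \<in> frac_ideal (n + v c)"
proof -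
  have "p / c - q / c * t = (p - q * t) / c" by (simp add: diff_divide_distrib)
  then show ?thesis using assms by (simp add: mem_scale_iff Lat_def frac_ideal_divide_iff)
qed

text \<open>Every later comparison of lattices reduces to this criterion. Necessity comes from
  testing the inclusion on the generators \<open>(d * s, d)\<close> and \<open>(z, 0)\<close> with
  \<open>v z = m + v d\<close>; sufficiency from
  \<open>p - q * t = (p - q * s) + q * (s - t)\<close>.\<close>

lemma scale_Lat_subset_iff:
  assumes c: "c \<noteq> 0" and d: "d \<noteq> 0"
  shows "scale d (Lat m s) \<subseteq> scale c (Lat n t) \<longleftrightarrow>
    v c \<le> v d \<and> n + v c \<le> m + v d \<and> s - t \<in> frac_ideal (n + v c - v d)"
proof
  assume sub: "scale d (Lat m s) \<subseteq> scale c (Lat n t)"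
  obtain z where z: "z \<noteq> 0" "v z = m + v d" by (rule v_surj)
  have "(d * s, d) \<in> scale d (Lat m s)" "(z, 0) \<in> scale d (Lat m s)"
    using d z by (simp_all add: mem_scale_Lat mem_frac_ideal)
  then have "(d * s, d) \<in> scale c (Lat n t)" "(z, 0) \<in> scale c (Lat n t)" using sub by auto
  then show "v c \<le> v d \<and> n + v c \<le> m + v d \<and> s - t \<in> frac_ideal (n + v c - v d)"
    using d z c
    by (simp add: mem_scale_Lat mem_frac_ideal frac_ideal_mult_iff flip: right_diff_distrib)
next
  assume *: "v c \<le> v d \<and> n + v c \<le> m + v d \<and> s - t \<in> frac_ideal (n + v c - v d)"
  show "scale d (Lat m s) \<subseteq> scale c (Lat n t)"
  proof (clarsimp simp: mem_scale_Lat c d)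
    fix p q assume q: "q \<in> frac_ideal (v d)" and p: "p - q * s \<in> frac_ideal (m + v d)"
    have "q * (s - t) \<in> frac_ideal (v d + (n + v c - v d))" using * q by (intro frac_ideal_mult) auto
    moreover have "p - q * s \<in> frac_ideal (n + v c)" using * p frac_ideal_mono by blast
    ultimately have "(p - q * s) + q * (s - t) \<in> frac_ideal (n + v c)" by (simp add: frac_ideal_add)
    moreover have "(p - q * s) + q * (s - t) = p - q * t" by (simp add: algebra_simps)
    ultimately show "q \<in> frac_ideal (v c) \<and> p - q * t \<in> frac_ideal (n + v c)"
      using * q frac_ideal_mono by auto
  qed
qed

lemma olattice_Lat: "olattice v (Lat n t)"
proof -
  obtain z where z: "z \<noteq> 0" "v z = n" by (rule v_surj)
  have "Lat n t = {(a * t + b * z, a * 1 + b * 0) | a b. a \<in> frac_ideal 0 \<and> b \<in> frac_ideal 0}" (is "_ = ?R")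
  proof
    show "Lat n t \<subseteq> ?R"
    proof (clarsimp simp: Lat_def)
      fix p q assume "q \<in> frac_ideal 0" and "p - q * t \<in> frac_ideal n"
      then show "\<exists>b. p = q * t + b * z \<and> b \<in> frac_ideal 0"
        using z by (intro exI[of _ "(p - q * t) / z"]) (simp add: frac_ideal_divide_iff)
    qed
    show "?R \<subseteq> Lat n t"
      using z frac_ideal_mult_iff[of z] by (auto simp: Lat_def mult.commute)
  qed
  then show ?thesis
    unfolding olattice_def intring_eq using z by (intro exI[of _ "(t, 1)"] exI[of _ "(z, 0)"]) auto
qed

lemma ballv_vertex [simp]: "ballv n t \<in> vertices v"
  using olattice_Lat by (auto simp: ballv_def vertices_def)

text \<open>Gaussian elimination with pivot \<open>u2\<close>: since \<open>w2 / u2\<close> is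
  integral, subtracting that multiple of the first basis vector from the second leaves
  \<open>(\<delta>, 0)\<close>. The determinant equals \<open>- u2 * \<delta>\<close>, so \<delta>
  is nonzero.\<close>

lemma span_eq_scale_Lat:
  assumes u2: "u2 \<noteq> 0" and w2: "w2 \<in> frac_ideal (v u2)" and det: "u1 * w2 - u2 * w1 \<noteq> 0"
  shows "{(a * u1 + b * w1, a * u2 + b * w2) | a b. a \<in> frac_ideal 0 \<and> b \<in> frac_ideal 0} =
    scale u2 (Lat (v (w1 - w2 * u1 / u2) - v u2) (u1 / u2))" (is "?L = ?R")
proof -
  define \<delta> where "\<delta> = w1 - w2 * u1 / u2"
  have "u2 * \<delta> = - (u1 * w2 - u2 * w1)" using u2 by (simp add: \<delta>_def algebra_simps)
  then have \<delta>: "\<delta> \<noteq> 0" using det by (metis mult_zero_right neg_equal_0_iff_equal)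
  have w1: "w1 = \<delta> + w2 * u1 / u2" by (simp add: \<delta>_def)
  have R: "(p, q) \<in> ?R \<longleftrightarrow> q \<in> frac_ideal (v u2) \<and> p - q * (u1 / u2) \<in> frac_ideal (v \<delta>)" for p q
    by (simp add: mem_scale_Lat[OF u2] \<delta>_def)
  show ?thesis
  proof (rule set_eqI, clarify)
    fix p q
    show "(p, q) \<in> ?L \<longleftrightarrow> (p, q) \<in> ?R"
    proof
      assume "(p, q) \<in> ?L"
      then obtain a b where ab: "a \<in> frac_ideal 0" "b \<in> frac_ideal 0"
        and p: "p = a * u1 + b * w1" and q: "q = a * u2 + b * w2" by auto
      have "p - q * (u1 / u2) = \<delta> * b"
        using u2 by (simp add: p q w1 field_simps)
      moreover have "q \<in> frac_ideal (v u2)"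
        unfolding q using frac_ideal_mult[OF ab(2) w2] ab(1) u2
        by (intro frac_ideal_add) (simp_all add: frac_ideal_mult_iff mult.commute[of a])
      ultimately show "(p, q) \<in> ?R" using ab(2) \<delta> by (simp only: R) (simp add: frac_ideal_mult_iff)
    next
      assume "(p, q) \<in> ?R"
      then have q: "q \<in> frac_ideal (v u2)" and p: "p - q * (u1 / u2) \<in> frac_ideal (v \<delta>)"
        by (simp_all only: R)
      define b where "b = (p - q * (u1 / u2)) / \<delta>"
      define a where "a = (q - b * w2) / u2"
      have b: "b \<in> frac_ideal 0" using p \<delta> by (simp add: b_def frac_ideal_divide_iff)
      have "q - b * w2 \<in> frac_ideal (v u2)"
        using q frac_ideal_mult[OF b w2] by (intro frac_ideal_diff) auto
      then have a: "a \<in> frac_ideal 0" using u2 by (simp add: a_def frac_ideal_divide_iff)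
      have "q = a * u2 + b * w2" using u2 by (simp add: a_def)
      moreover have "a * u1 + b * w1 = q * (u1 / u2) + b * \<delta>"
        using u2 by (simp add: a_def w1 field_simps)
      then have "p = a * u1 + b * w1" using \<delta> by (simp add: b_def)
      ultimately show "(p, q) \<in> ?L" using a b by blast
    qed
  qed
qed

lemma vertex_ballv:
  assumes "X \<in> vertices v"
  obtains n t where "X = ballv n t"
proof -
  obtain L where L: "olattice v L" "X = hclass L" using assms by (auto simp: vertices_def)
  obtain u w where det: "fst u * snd w - snd u * fst w \<noteq> 0"
    and Luw: "L = {(a * fst u + b * fst w, a * snd u + b * snd w) | a b. a \<in> frac_ideal 0 \<and> b \<in> frac_ideal 0}"
    using L(1) by (auto simp: olattice_def intring_eq)
  have Lwu: "L = {(a * fst w + b * fst u, a * snd w + b * snd u) | a b. a \<in> frac_ideal 0 \<and> b \<in> frac_ideal 0}"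
  proof -
    have "L = {(b * fst u + a * fst w, b * snd u + a * snd w) | a b. a \<in> frac_ideal 0 \<and> b \<in> frac_ideal 0}"
      unfolding Luw by blast
    then show ?thesis by (simp only: add.commute)
  qed
  have det': "fst w * snd u - snd w * fst u \<noteq> 0" using det by (simp add: algebra_simps)
  have "\<exists>c n t. c \<noteq> 0 \<and> L = scale c (Lat n t)"
  \<comment> \<open>The pivot is a nonzero second coordinate of least valuation; one exists because
    the determinant does not vanish. Exchanging the two basis vectors only changes its sign.\<close>
  proof (cases "snd u \<noteq> 0 \<and> snd w \<in> frac_ideal (v (snd u))")
    case True
    then show ?thesis using span_eq_scale_Lat[OF _ _ det] Luw by blast
  next
    case False
    then have "snd w \<noteq> 0 \<and> snd u \<in> frac_ideal (v (snd w))"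
      using det by (auto simp: frac_ideal_def)
    then show ?thesis using span_eq_scale_Lat[OF _ _ det'] Lwu by blast
  qed
  then show ?thesis using L(2) that by (auto simp: ballv_def hclass_scale)
qed

lemma ballv_eq_iff: "ballv n t = ballv m s \<longleftrightarrow> n = m \<and> s - t \<in> frac_ideal n"
proof
  assume "ballv n t = ballv m s"
  \<comment> \<open>The factor 1 is written out so that the inclusion criterion applies in both
    directions; together they force \<open>v c = 0\<close>.\<close>
  then obtain c where c: "c \<noteq> 0" "scale 1 (Lat m s) = scale c (Lat n t)"
    by (auto simp: ballv_def hclass_eq_iff)
  then have "scale 1 (Lat m s) \<subseteq> scale c (Lat n t)" "scale c (Lat n t) \<subseteq> scale 1 (Lat m s)" by auto
  then have "v c \<le> 0" "n + v c \<le> m" "s - t \<in> frac_ideal (n + v c)" "0 \<le> v c" "m \<le> n + v c"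
    unfolding scale_Lat_subset_iff[OF c(1) one_neq_zero] scale_Lat_subset_iff[OF one_neq_zero c(1)]
    by simp_all
  moreover from this have "v c = 0" by simp
  ultimately show "n = m \<and> s - t \<in> frac_ideal n" by simp
next
  assume *: "n = m \<and> s - t \<in> frac_ideal n"
  then have "scale 1 (Lat n t) = scale 1 (Lat m s)"
    using frac_ideal_diff_commute[of s t n]
    by (intro subset_antisym) (auto simp add: scale_Lat_subset_iff simp del: scale_one)
  then show "ballv n t = ballv m s" by (simp add: ballv_def)
qed

section \<open>Edges as pairs of a ball and a maximal subball\<close>

text \<open>Scaling \<open>L' \<subset> L\<close> by the uniformizer puts
  \<open>scale (unif v) L\<close>, another representative of \<open>X\<close>, strictly between
  \<open>scale (unif v) L'\<close> and \<open>L'\<close>.\<close>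

lemma adj_sym:
  assumes "adj v X Y"
  shows "adj v Y X"
proof -
  obtain L L' where L: "L \<in> X" "L' \<in> Y" "scale (unif v) L \<subset> L'" "L' \<subset> L"
    and V: "X \<in> vertices v" "Y \<in> vertices v"
    using assms by (auto simp: adj_def)
  have "inj (\<lambda>p::'a \<times> 'a. (unif v * fst p, unif v * snd p))"
    using v_unif by (auto simp: inj_on_def prod_eq_iff)
  then have "scale (unif v) L' \<subset> scale (unif v) L"
    using L(4) unfolding scale_def by (meson image_strict_mono inj_on_subset subset_UNIV)
  moreover have "scale (unif v) L \<in> X"
  proof -
    obtain K where "X = hclass K" using V by (auto simp: vertices_def)
    with L(1) obtain c where "c \<noteq> 0" "L = scale c K" by (auto simp: mem_hclass_iff)
    then show ?thesis using v_unif
      unfolding \<open>X = hclass K\<close> mem_hclass_iff by (intro exI[of _ "unif v * c"]) (simp add: scale_scale)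
  qed
  ultimately show ?thesis using L V unfolding adj_def by blast
qed

text \<open>This orients every edge away from the end at infinity. A centre of the smaller ball is
  also a centre of the larger one, so a single \<open>t\<close> serves both.\<close>

definition child :: "'a vertex \<Rightarrow> 'a vertex \<Rightarrow> bool" where
  "child X Y \<longleftrightarrow> (\<exists>n t. X = ballv n t \<and> Y = ballv (n + 1) t)"

lemma childI: "child (ballv n t) (ballv (n + 1) t)"
  by (auto simp: child_def)

lemma child_imp_adj:
  assumes "child X Y"
  shows "adj v X Y"
proof -
  obtain n t where X: "X = ballv n t" and Y: "Y = ballv (n + 1) t" using assms by (auto simp: child_def)
  have "scale (unif v) (Lat n t) \<subset> scale 1 (Lat (n + 1) t)" "scale 1 (Lat (n + 1) t) \<subset> scale 1 (Lat n t)"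
    unfolding less_le_not_le using v_unif by (simp_all add: scale_Lat_subset_iff del: scale_one)
  then have "scale (unif v) (Lat n t) \<subset> Lat (n + 1) t" "Lat (n + 1) t \<subset> Lat n t" by simp_all
  moreover have "Lat n t \<in> X" "Lat (n + 1) t \<in> Y"
    by (auto simp: X Y ballv_def mem_hclass_iff intro: exI[of _ 1])
  ultimately show ?thesis unfolding adj_def using X Y ballv_vertex by blast
qed

text \<open>The inclusions confine the relative scaling exponent \<open>j\<close> to 0 or 1 and
  \<open>m + j\<close> to \<open>n\<close> or \<open>n + 1\<close>. Strictness discards the two
  cases with \<open>m = n\<close>, and the other two are the two orientations of the edge.\<close>

lemma adj_iff_child: "adj v X Y \<longleftrightarrow> child X Y \<or> child Y X"
proof
  assume adj: "adj v X Y"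
  then obtain n t m s where X: "X = ballv n t" and Y: "Y = ballv m s"
    by (metis adj_def vertex_ballv)
  obtain L L' where "L \<in> X" "L' \<in> Y" and sub: "scale (unif v) L \<subset> L'" "L' \<subset> L"
    using adj by (auto simp: adj_def)
  then obtain c d where c: "c \<noteq> 0" "L = scale c (Lat n t)" and d: "d \<noteq> 0" "L' = scale d (Lat m s)"
    by (auto simp: X Y ballv_def mem_hclass_iff)
  define j where "j = v d - v c"
  have uc: "unif v * c \<noteq> 0" "v (unif v * c) = v c + 1" using v_unif c by (auto simp: v_mult)
  have incl: "0 \<le> j" "j \<le> 1" "n \<le> m + j" "m + j \<le> n + 1"
      "s - t \<in> frac_ideal (n - j)" "s - t \<in> frac_ideal (m + j - 1)"
    and strict: "\<not> (j = 0 \<and> m = n \<and> s - t \<in> frac_ideal n)" "\<not> (j = 1 \<and> m = n \<and> s - t \<in> frac_ideal n)"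
    using sub[unfolded less_le_not_le c(2) d(2) scale_scale scale_Lat_subset_iff[OF uc(1) d(1)]
        scale_Lat_subset_iff[OF d(1) uc(1)] scale_Lat_subset_iff[OF c(1) d(1)]
        scale_Lat_subset_iff[OF d(1) c(1)] uc(2)]
    by (auto simp: j_def algebra_simps frac_ideal_diff_commute[of t])
  consider "j = 0" "m = n" | "j = 0" "m = n + 1" | "j = 1" "n = m + 1" | "j = 1" "m = n"
    using incl(1-4) by linarith
  then show "child X Y \<or> child Y X"
  proof cases
    case 2
    then have "X = ballv n s" using incl by (simp add: X ballv_eq_iff)
    then show ?thesis using 2 Y childI by blast
  next
    case 3
    then have "Y = ballv m t" using incl by (simp add: Y ballv_eq_iff frac_ideal_diff_commute)
    then show ?thesis using 3 X childI by blast
  qed (use incl strict in auto)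
qed (auto intro: child_imp_adj adj_sym)

text \<open>By the ultrametric inequality, two balls of equal radius with a common subball coincide.
  The path arguments below rest on this tree property.\<close>

lemma child_parent_unique: "child X Z \<Longrightarrow> child Y Z \<Longrightarrow> X = Y"
  by (clarsimp simp only: child_def ballv_eq_iff) (auto intro: frac_ideal_mono)

lemma child_ballv:
  assumes "child (ballv n t) Y"
  obtains s where "Y = ballv (n + 1) s" "s - t \<in> frac_ideal n"
  using assms by (auto simp: child_def ballv_eq_iff)

lemma adj_neq: "adj v X Y \<Longrightarrow> X \<noteq> Y"
  by (auto simp: adj_iff_child child_def ballv_eq_iff)

text \<open>The only upward neighbour of \<open>Y\<close> is \<open>X\<close>, so a path that has
  gone down once and does not backtrack must keep going down.\<close>

lemma child_step: "child X Y \<Longrightarrow> adj v Y Z \<Longrightarrow> X \<noteq> Z \<Longrightarrow> child Y Z"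
  using child_parent_unique by (auto simp: adj_iff_child)

lemma relpowp_adj_up: "(adj v ^^ k) (ballv n t) (ballv (n - int k) t)"
proof (induction k)
  case (Suc k)
  have "child (ballv (n - int (Suc k)) t) (ballv (n - int k) t)"
    using childI[of "n - int (Suc k)" t] by (simp add: algebra_simps)
  then show ?case using Suc by (auto simp: adj_iff_child)
qed simp

lemma adj_connected:
  assumes "X \<in> vertices v" "Y \<in> vertices v"
  shows "\<exists>k. (adj v ^^ k) X Y"
proof -
  have up: "(adj v)\<^sup>*\<^sup>* (ballv n t) (ballv k t)" if "k \<le> n" for n k t
    using relpowp_adj_up[of "nat (n - k)" n t] that by (auto dest: relpowp_imp_rtranclp)
  have sym: "symp ((adj v)\<^sup>*\<^sup>*)" by (rule symp_rtranclp) (auto intro: sympI adj_sym)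
  obtain n t m s where X: "X = ballv n t" and Y: "Y = ballv m s" using assms vertex_ballv by metis
  \<comment> \<open>The balls of index \<open>k\<close> around \<open>t\<close> and \<open>s\<close>
    coincide and contain both given balls. If \<open>s = t\<close>, the value \<open>v 0\<close> is
    arbitrary but harmless, since 0 lies in every \<open>frac_ideal\<close>.\<close>
  define k where "k = min (min n m) (v (s - t))"
  have "ballv k t = ballv k s" by (auto simp: ballv_eq_iff frac_ideal_def k_def)
  then have "(adj v)\<^sup>*\<^sup>* X (ballv k t)" "(adj v)\<^sup>*\<^sup>* Y (ballv k t)"
    using up[of k n t] up[of k m s] by (auto simp: X Y k_def)
  then have "(adj v)\<^sup>*\<^sup>* X Y" using sym by (meson rtranclp_trans sympD)
  then show ?thesis by (simp add: rtranclp_power)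
qed

section \<open>Automorphisms, and closure of \<open>Ghat\<close> under composition\<close>

text \<open>\<open>aut\<close> speaks of distances only; this makes automorphisms preserve edges.
  Connectedness guarantees that the \<open>LEAST\<close> in \<open>tdist\<close> is
  attained.\<close>

lemma adj_iff_tdist:
  assumes "X \<in> vertices v" "Y \<in> vertices v"
  shows "adj v X Y \<longleftrightarrow> tdist v X Y = 1"
proof
  assume *: "adj v X Y"
  show "tdist v X Y = 1" unfolding tdist_eq
  proof (rule Least_equality)
    fix k assume "(adj v ^^ k) X Y"
    then show "1 \<le> k" using adj_neq[OF *] by (cases k) auto
  qed (use * in \<open>simp add: OO_def\<close>)
next
  assume "tdist v X Y = 1"
  moreover have "(adj v ^^ tdist v X Y) X Y"
    unfolding tdist_eq using adj_connected[OF assms] by (rule LeastI_ex)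
  ultimately show "adj v X Y" by (simp add: OO_def)
qed

lemma aut_vertex: "aut v g \<Longrightarrow> X \<in> vertices v \<Longrightarrow> g X \<in> vertices v"
  by (auto simp: aut_def bij_betw_def)

lemma aut_adj_iff:
  assumes "aut v g" "X \<in> vertices v" "Y \<in> vertices v"
  shows "adj v (g X) (g Y) \<longleftrightarrow> adj v X Y"
  using assms aut_vertex[OF assms(1)] by (auto simp: adj_iff_tdist aut_def)

text \<open>An isometry \<open>h\<close> carries the ball around an edge into the ball around the
  image edge. There \<open>g\<close> agrees with some matrix, and its product with the matrix for
  \<open>h\<close> represents the composite.\<close>

lemma Ghat_comp:
  assumes g: "g \<in> Ghat v e" and h: "h \<in> Ghat v e"
  shows "g \<circ> h \<in> Ghat v e"
proof -
  have ag: "aut v g" and ah: "aut v h" using g h by (auto simp: Ghat_def)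
  have "\<exists>M. mat_inv M \<and> (\<forall>y\<in>ball_edge v y1 y2 e. (g \<circ> h) y = pgl_act v M y)" if adj: "adj v y1 y2" for y1 y2
  proof -
    have V: "y1 \<in> vertices v" "y2 \<in> vertices v" using adj by (auto simp: adj_def)
    obtain N where N: "mat_inv N" "\<And>y. y \<in> ball_edge v y1 y2 e \<Longrightarrow> h y = pgl_act v N y"
      using h adj unfolding Ghat_def by blast
    have "adj v (h y1) (h y2)" using aut_adj_iff[OF ah V] adj by simp
    then obtain M where M: "mat_inv M" "\<And>y. y \<in> ball_edge v (h y1) (h y2) e \<Longrightarrow> g y = pgl_act v M y"
      using g unfolding Ghat_def by blast
    have "h y \<in> ball_edge v (h y1) (h y2) e" if "y \<in> ball_edge v y1 y2 e" for y
      using that ah V by (auto simp: ball_edge_def aut_vertex) (auto simp: aut_def)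
    then show ?thesis
      using M N by (intro exI[of _ "mat_mult M N"]) (auto simp: mat_inv_mult pgl_act_mult)
  qed
  then show ?thesis using aut_comp[OF ag ah] by (auto simp: Ghat_def)
qed

section \<open>Translations, dilations and inversion acting on balls\<close>

lemma matact_translation_Lat: "matact (1, s, 0, 1) ` Lat n t = Lat n (t + s)"
proof
  show "Lat n (t + s) \<subseteq> matact (1, s, 0, 1) ` Lat n t"
  proof clarify
    fix p q assume "(p, q) \<in> Lat n (t + s)"
    then have "(p - q * s, q) \<in> Lat n t" by (simp add: Lat_def algebra_simps)
    moreover have "(p, q) = matact (1, s, 0, 1) (p - q * s, q)" by (simp add: matact_def)
    ultimately show "(p, q) \<in> matact (1, s, 0, 1) ` Lat n t" by blast
  qed
qed (auto simp: Lat_def matact_def algebra_simps)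

lemma pgl_act_translation: "pgl_act v (1, s, 0, 1) (ballv n t) = ballv n (t + s)"
  unfolding ballv_def pgl_act_hclass[OF olattice_Lat] matact_translation_Lat ..

lemma pgl_act_dilation:
  assumes "d \<noteq> 0"
  shows "pgl_act v (d, 0, 0, 1) (ballv n 0) = ballv (n + v d) 0"
proof -
  have "matact (d, 0, 0, 1) ` Lat n 0 = Lat (n + v d) 0"
  proof
    show "Lat (n + v d) 0 \<subseteq> matact (d, 0, 0, 1) ` Lat n 0"
    proof clarify
      fix p q assume "(p, q) \<in> Lat (n + v d) 0"
      then have "(p / d, q) \<in> Lat n 0" using assms by (simp add: Lat_def frac_ideal_divide_iff)
      moreover have "(p, q) = matact (d, 0, 0, 1) (p / d, q)" using assms by (simp add: matact_def)
      ultimately show "(p, q) \<in> matact (d, 0, 0, 1) ` Lat n 0" by blast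
    qed
  qed (use assms in \<open>auto simp: Lat_def matact_def frac_ideal_mult_iff\<close>)
  then show ?thesis by (simp add: ballv_def pgl_act_hclass olattice_Lat)
qed

text \<open>Exchanging coordinates turns the basis \<open>(0, 1)\<close>, \<open>(z, 0)\<close> into
  \<open>(1, 0)\<close>, \<open>(0, z)\<close>, which is \<open>z\<close> times a basis of
  \<open>Lat (- n) 0\<close>.\<close>

lemma pgl_act_swap: "pgl_act v (0, 1, 1, 0) (ballv n 0) = ballv (- n) 0"
proof -
  obtain z where z: "z \<noteq> 0" "v z = n" by (rule v_surj)
  have "matact (0, 1, 1, 0) ` Lat n 0 = scale z (Lat (- n) 0)"
  proof
    show "scale z (Lat (- n) 0) \<subseteq> matact (0, 1, 1, 0) ` Lat n 0"
    proof clarify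
      fix p q assume "(p, q) \<in> scale z (Lat (- n) 0)"
      then have "q \<in> frac_ideal n \<and> p \<in> frac_ideal 0"
        using mem_scale_Lat[OF z(1), of p q "- n" 0] z(2) by simp
      then have "(q, p) \<in> Lat n 0" by (simp add: Lat_def)
      moreover have "(p, q) = matact (0, 1, 1, 0) (q, p)" by (simp add: matact_def)
      ultimately show "(p, q) \<in> matact (0, 1, 1, 0) ` Lat n 0" by blast
    qed
    show "matact (0, 1, 1, 0) ` Lat n 0 \<subseteq> scale z (Lat (- n) 0)"
    proof (rule image_subsetI, clarify)
      fix p q assume "(p, q) \<in> Lat n 0"
      then have "(q, p) \<in> scale z (Lat (- n) 0)"
        using mem_scale_Lat[OF z(1), of q p "- n" 0] z(2) by (simp add: Lat_def)
      then show "matact (0, 1, 1, 0) (p, q) \<in> scale z (Lat (- n) 0)" by (simp add: matact_def)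
    qed
  qed
  then show ?thesis by (simp add: ballv_def pgl_act_hclass olattice_Lat hclass_scale[OF z(1)])
qed

section \<open>Descending sequences of balls and their limits\<close>

lemma child_parent: "child X (ballv n t) \<Longrightarrow> X = ballv (n - 1) t"
  using childI[of "n - 1" t] child_parent_unique by simp

text \<open>Parents are unique, so one ball determines all earlier ones, with the same centre. Here
  \<open>c\<close> is the constant offset between the index along the path and the radius
  index.\<close>

lemma child_sequence_below:
  fixes N :: int
  assumes "y N = ballv (N + c) t" and "\<And>n. n < N \<Longrightarrow> child (y n) (y (n + 1))" and "n \<le> N"
  shows "y n = ballv (n + c) t"
  using assms(3)
proof (induction n rule: int_le_induct)
  case (step i)
  then show ?case using assms(2)[of "i - 1"] child_parent[of "y (i - 1)" "i + c" t]
    by (simp add: algebra_simps)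
qed (use assms in simp)

lemma nonbacktracking_child:
  fixes N :: int
  assumes "child (y N) (y (N + 1))" and "\<And>n. N \<le> n \<Longrightarrow> adj v (y n) (y (n + 1))"
    and "\<And>n. N < n \<Longrightarrow> y (n - 1) \<noteq> y (n + 1)" and "N \<le> n"
  shows "child (y n) (y (n + 1))"
  using assms(4)
proof (induction n rule: int_ge_induct)
  case (step i)
  then show ?case using child_step[of "y i" "y (i + 1)" "y (i + 2)"] assms(2)[of "i + 1"] assms(3)[of "i + 1"]
    by (simp add: algebra_simps)
qed (use assms in simp)

lemma child_ray_ballv:
  fixes N :: int
  assumes "y N = ballv (N + c) t" and "\<And>n. N \<le> n \<Longrightarrow> child (y n) (y (n + 1))" and "N \<le> n"
  shows "\<exists>s. y n = ballv (n + c) s"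
  using assms(3)
proof (induction n rule: int_ge_induct)
  case (step i)
  then obtain s where "y i = ballv (i + c) s" by blast
  then show ?case using assms(2)[OF step(1)] child_ballv[of "i + c" s "y (i + 1)"]
    by (metis add.commute add.left_commute)
qed (use assms in blast)

text \<open>Completeness makes a descending sequence of balls have a common point.\<close>

lemma child_ray_limit:
  fixes N :: int
  assumes complete: "complete_dval v" and N: "y N = ballv (N + c) t0"
    and child: "\<And>n. N \<le> n \<Longrightarrow> child (y n) (y (n + 1))"
  obtains t where "\<And>n. N \<le> n \<Longrightarrow> y n = ballv (n + c) t"
proof -
  \<comment> \<open>A choice of one centre for each ball. Each centre lies in all earlier balls,
    which makes the sequence Cauchy.\<close>
  define \<tau> where "\<tau> k = (SOME s. y (N + int k) = ballv (N + int k + c) s)" for k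
  have \<tau>: "y (N + int k) = ballv (N + int k + c) (\<tau> k)" for k
    unfolding \<tau>_def by (rule someI_ex, rule child_ray_ballv[of y N, OF N child]) simp_all
  have step: "\<tau> (Suc k) - \<tau> k \<in> frac_ideal (N + int k + c)" for k
  proof -
    have "child (ballv (N + int k + c) (\<tau> k)) (ballv (N + int (Suc k) + c) (\<tau> (Suc k)))"
      using child[of "N + int k"] \<tau>[of k] \<tau>[of "Suc k"] by (simp add: algebra_simps)
    then obtain s where s: "ballv (N + int (Suc k) + c) (\<tau> (Suc k)) = ballv (N + int k + c + 1) s"
      "s - \<tau> k \<in> frac_ideal (N + int k + c)" by (rule child_ballv)
    then have "s - \<tau> (Suc k) \<in> frac_ideal (N + int k + c)"
      by (auto simp: ballv_eq_iff intro: frac_ideal_mono)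
    then show ?thesis using s(2) frac_ideal_diff_commute frac_ideal_diff_trans by blast
  qed
  have diff: "\<tau> m - \<tau> k \<in> frac_ideal (N + int k + c)" if "k \<le> m" for k m
    using that
  proof (induction m rule: dec_induct)
    case (step m)
    have "\<tau> (Suc m) - \<tau> m \<in> frac_ideal (N + int k + c)"
      using \<open>\<And>k. \<tau> (Suc k) - \<tau> k \<in> _\<close>[of m] step by (auto intro: frac_ideal_mono)
    then show ?case using step frac_ideal_diff_trans by blast
  qed simp
  have "\<exists>K. \<forall>m\<ge>K. \<forall>n\<ge>K. \<tau> m - \<tau> n \<in> frac_ideal k" for k
  proof (intro exI allI impI)
    fix m n assume "nat (k - N - c) \<le> m" "nat (k - N - c) \<le> n"
    then have "\<tau> m - \<tau> (nat (k - N - c)) \<in> frac_ideal k" "\<tau> n - \<tau> (nat (k - N - c)) \<in> frac_ideal k"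
      by (auto intro!: frac_ideal_mono[OF diff])
    then show "\<tau> m - \<tau> n \<in> frac_ideal k"
      using frac_ideal_diff_commute frac_ideal_diff_trans by blast
  qed
  then obtain l where l: "\<And>k. \<exists>K. \<forall>n\<ge>K. \<tau> n - l \<in> frac_ideal k"
    using complete unfolding complete_dval_def frac_ideal_def mem_Collect_eq by blast
  have "y n = ballv (n + c) l" if "N \<le> n" for n
  proof -
    define k where "k = nat (n - N)"
    have n: "n = N + int k" using that by (simp add: k_def)
    obtain K where "\<And>j. K \<le> j \<Longrightarrow> \<tau> j - l \<in> frac_ideal (n + c)" using l by blast
    \<comment> \<open>An index late enough that its centre is close both to the limit
      \<open>l\<close> and to \<open>\<tau> k\<close>.\<close>
    then have "\<tau> (max K k) - l \<in> frac_ideal (n + c)" by simp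
    moreover have "\<tau> (max K k) - \<tau> k \<in> frac_ideal (n + c)" using diff[of k "max K k"] n by simp
    ultimately have "l - \<tau> k \<in> frac_ideal (n + c)"
      using frac_ideal_diff_commute frac_ideal_diff_trans by blast
    then show ?thesis using \<tau>[of k] by (simp add: n ballv_eq_iff)
  qed
  then show ?thesis using that by blast
qed

section \<open>Moving doubly infinite paths to the standard one\<close>

lemma pgl_act_eq_iff: "mat_inv M \<Longrightarrow> pgl_act v M X = pgl_act v M Y \<longleftrightarrow> X = Y"
  by (metis pgl_act_inverse(2))

lemma dpath_pgl_act: "mat_inv M \<Longrightarrow> dpath v x \<Longrightarrow> dpath v (\<lambda>n. pgl_act v M (x n))"
  by (simp add: dpath_def adj_pgl_act pgl_act_eq_iff)

lemma dpath_vertex: "dpath v x \<Longrightarrow> x n \<in> vertices v"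
  by (simp add: dpath_def adj_def)

lemma dpath_child:
  assumes "dpath v x" "child (x N) (x (N + 1))" "N \<le> n"
  shows "child (x n) (x (n + 1))"
  by (rule nonbacktracking_child[of x N, OF assms(2) _ _ assms(3)]) (use assms(1) in \<open>simp_all add: dpath_def\<close>)

text \<open>The shift \<open>a\<close> lets the reversal be centred where needed:
  \<open>m + 1\<close> below for an ascending edge, and 1 for exchanging \<open>x 0\<close> and
  \<open>x 1\<close>.\<close>

lemma dpath_reverse: "dpath v x \<Longrightarrow> dpath v (\<lambda>n. x (a - n))"
proof -
  assume x: "dpath v x"
  have "adj v (x (a - n)) (x (a - (n + 1)))" for n
  proof -
    have "adj v (x (a - (n + 1))) (x (a - (n + 1) + 1))" using x by (simp only: dpath_def)
    moreover have "a - (n + 1) + 1 = a - n" by simp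
    ultimately show ?thesis by (simp only: adj_sym)
  qed
  moreover have "x (a - (n - 1)) \<noteq> x (a - (n + 1))" for n
  proof -
    have "x (a - n + 1) \<noteq> x (a - n - 1)" using x unfolding dpath_def by metis
    moreover have "a - (n - 1) = a - n + 1" "a - (n + 1) = a - n - 1" by simp_all
    ultimately show ?thesis by (simp only: not_False_eq_True)
  qed
  ultimately show ?thesis by (simp add: dpath_def)
qed

text \<open>Such a path runs from infinity to a point \<open>t\<close> of the field. Translation by
  \<open>-t\<close> moves this point to 0, and a dilation of valuation \<open>- c\<close> removes
  the offset between index and radius.\<close>

lemma descending_path_standard:
  assumes complete: "complete_dval v" and child: "\<And>n. child (x n) (x (n + 1))"
  shows "\<exists>M. mat_inv M \<and> (\<forall>n. pgl_act v M (x n) = ballv n 0)"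
proof -
  obtain c t0 where "x 0 = ballv (0 + c) t0" using child[of 0] by (auto simp: child_def)
  then obtain t where t: "\<And>n. 0 \<le> n \<Longrightarrow> x n = ballv (n + c) t"
    using child_ray_limit[OF complete, of x 0 c t0] child by blast
  have x: "x n = ballv (n + c) t" for n
    using child_sequence_below[of x 0 c t n] t child by (cases "0 \<le> n") auto
  obtain d where d: "d \<noteq> 0" "v d = - c" by (rule v_surj)
  have inv: "mat_inv (d, 0, 0, 1)" "mat_inv (1, - t, 0, 1)" using d by (auto simp: mat_inv_def)
  have "pgl_act v (mat_mult (d, 0, 0, 1) (1, - t, 0, 1)) (x n) = ballv n 0" for n
    using d by (simp add: pgl_act_mult inv x pgl_act_translation pgl_act_dilation del: mat_mult.simps)
  then show ?thesis using mat_inv_mult[OF inv] by blast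
qed

text \<open>If the path ascends somewhere, its backward end is a point \<open>t\<close> of the field, which the inversion
  \<open>z \<mapsto> 1 / (z - t)\<close> moves to infinity.\<close>

lemma dpath_standard:
  assumes complete: "complete_dval v" and x: "dpath v x"
  obtains M where "mat_inv M" "\<And>n. pgl_act v M (x n) = ballv n 0"
proof (cases "\<forall>n. child (x n) (x (n + 1))")
  case True
  then show ?thesis using descending_path_standard[OF complete, of x] that by blast
next
  case False
  then obtain m where m: "child (x (m + 1)) (x m)" using x by (auto simp: dpath_def adj_iff_child)
  define z where "z n = x (m + 1 - n)" for n
  have z: "dpath v z" unfolding z_def by (rule dpath_reverse[OF x])
  have child: "child (z n) (z (n + 1))" if "0 \<le> n" for n
    using dpath_child[OF z, of 0 n] m that by (simp add: z_def)
  obtain c t0 where "z 0 = ballv (0 + c) t0" using child[of 0] by (auto simp: child_def)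
  then obtain t where t: "\<And>n. 0 \<le> n \<Longrightarrow> z n = ballv (n + c) t"
    using child_ray_limit[OF complete, of z 0 c t0] child by blast
  define M where "M = mat_mult (0, 1, 1, 0) (1, - t, 0, 1)"
  have inv: "mat_inv (0::'a, 1, 1, 0)" "mat_inv (1, - t, 0, 1)" by (auto simp: mat_inv_def)
  have M: "mat_inv M" unfolding M_def by (rule mat_inv_mult[OF inv])
  define y where "y n = pgl_act v M (x n)" for n
  have y: "dpath v y" unfolding y_def by (rule dpath_pgl_act[OF M x])
  have y_ballv: "y n = ballv (n - m - 1 - c) 0" if "n \<le> m + 1" for n
    using t[of "m + 1 - n"] that
    by (simp add: y_def M_def z_def pgl_act_mult inv pgl_act_translation pgl_act_swap algebra_simps
        del: mat_mult.simps)
  have "child (y n) (y (n + 1))" for n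
  \<comment> \<open>At \<open>min n m\<close> this term and the next are both known explicitly; the
    absence of backtracking carries the descent on to \<open>n\<close>.\<close>
  proof (rule dpath_child[OF y])
    show "child (y (min n m)) (y (min n m + 1))"
      using childI[of "min n m - m - 1 - c" 0] by (simp add: y_ballv algebra_simps)
  qed simp
  then obtain N where N: "mat_inv N" "\<And>n. pgl_act v N (y n) = ballv n 0"
    using descending_path_standard[OF complete, of y] by blast
  show ?thesis
    using that[of "mat_mult N M"] N M by (simp add: mat_inv_mult pgl_act_mult y_def)
qed

text \<open>In standard coordinates the ray \<open>y\<close> converges to a point \<open>t\<close> of the field, and the
  translation by \<open>-t\<close> moves it to the standard one.\<close>

lemma pgl_act_align_ray:
  assumes complete: "complete_dval v" and x: "dpath v x" and y: "dpath v y"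
    and xy: "y 0 = x 0" "y 1 = x 1"
  obtains U where "mat_inv U" "\<And>n. 0 \<le> n \<Longrightarrow> pgl_act v U (y n) = x n"
    "\<And>n. n \<le> 1 \<Longrightarrow> pgl_act v U (x n) = x n"
proof -
  obtain M where M: "mat_inv M" "\<And>n. pgl_act v M (x n) = ballv n 0"
    using dpath_standard[OF complete x] by blast
  have x_eq: "x n = pgl_act v (mat_inverse M) (ballv n 0)" for n
    using pgl_act_inverse(2)[OF M(1), of v "x n"] M(2) by simp
  define z where "z n = pgl_act v M (y n)" for n
  have z: "dpath v z" unfolding z_def by (rule dpath_pgl_act[OF M(1) y])
  have z01: "z 0 = ballv 0 0" "z 1 = ballv 1 0" by (simp_all add: z_def xy M(2))
  have "child (z n) (z (n + 1))" if "0 \<le> n" for n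
    using dpath_child[OF z, of 0 n] childI[of 0 0] that by (simp add: z01)
  then obtain t where t: "\<And>n. 0 \<le> n \<Longrightarrow> z n = ballv (n + 0) t"
    using child_ray_limit[OF complete, of z 0 0 0] z01(1) by auto
  \<comment> \<open>The ray passes through \<open>ballv 1 0\<close>, so its limit lies in that ball.
    Hence translation by \<open>-t\<close> fixes every ball around 0 of index at most 1, and
    \<open>U\<close> below is this translation in the original coordinates.\<close>
  have t1: "t \<in> frac_ideal 1" using t[of 1] by (simp add: z01 ballv_eq_iff)
  define T :: "'a mat2" where "T = (1, - t, 0, 1)"
  have T: "mat_inv T" by (simp add: T_def mat_inv_def)
  define U where "U = mat_mult (mat_inverse M) (mat_mult T M)"
  have TM: "mat_inv (mat_mult T M)" using T M by (simp add: mat_inv_mult)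
  have U: "pgl_act v U X = pgl_act v (mat_inverse M) (pgl_act v T (pgl_act v M X))" for X
    using TM M by (simp add: U_def pgl_act_mult)
  show ?thesis
  proof (rule that)
    show "mat_inv U" unfolding U_def using TM M by (simp add: mat_inv_mult mat_inv_inverse)
    show "pgl_act v U (y n) = x n" if "0 \<le> n" for n
      using t[OF that] by (simp add: U x_eq T_def pgl_act_translation flip: z_def)
    show "pgl_act v U (x n) = x n" if "n \<le> 1" for n
    proof -
      have "pgl_act v T (ballv n 0) = ballv n 0"
        using frac_ideal_mono[OF t1 that] by (simp add: T_def pgl_act_translation ballv_eq_iff)
      then show ?thesis by (simp add: U M(2)) (simp add: x_eq)
    qed
  qed
qed

section \<open>From fixed ends to fixed vertices\<close>

text \<open>In standard coordinates the image of the ray descends from the fixed edge, so its n-th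
  ball has index n. Comparing indices far out forces the shift \<open>k\<close> to be 0, and
  uniqueness of parents brings the agreement back from there to every
  \<open>n \<ge> 0\<close>.\<close>

lemma fixes_ray_of_fixes_end:
  assumes complete: "complete_dval v" and x: "dpath v x" and g: "aut v g"
    and fix01: "g (x 0) = x 0" "g (x 1) = x 1" and fwd: "fixes_end_fwd g x" and n: "0 \<le> n"
  shows "g (x n) = x n"
proof -
  obtain M where M: "mat_inv M" "\<And>n. pgl_act v M (x n) = ballv n 0"
    using dpath_standard[OF complete x] by blast
  define y where "y n = pgl_act v M (g (x n))" for n
  have "dpath v (\<lambda>n. g (x n))"
    using x g dpath_vertex[OF x] by (auto simp: dpath_def aut_adj_iff aut_def bij_betw_def inj_on_eq_iff)
  then have y: "dpath v y" unfolding y_def by (rule dpath_pgl_act[OF M(1)])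
  have y01: "y 0 = ballv (0 + 0) 0" "y 1 = ballv 1 0" by (simp_all add: y_def fix01 M(2))
  have child: "child (y n) (y (n + 1))" if "0 \<le> n" for n
    using dpath_child[OF y, of 0 n] childI[of 0 0] that by (simp add: y01)
  obtain k N where kN: "\<And>n. N \<le> n \<Longrightarrow> g (x n) = x (n + k)" using fwd by (auto simp: fixes_end_fwd_def)
  define m where "m = max n N"
  have ym: "y m = ballv (m + k) 0" by (simp add: y_def kN m_def M(2))
  moreover obtain s where "y m = ballv (m + 0) s"
    using child_ray_ballv[OF y01(1) child, of m] n unfolding m_def by fastforce
  ultimately have "k = 0" by (simp add: ballv_eq_iff)
  have "y n = ballv (n + 0) 0"
  proof -
    \<comment> \<open>The image ray is continued by the standard path at negative indices, because
      \<open>child_sequence_below\<close> asks for descent at every index below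
      \<open>m\<close>.\<close>
    define w where "w j = (if 0 \<le> j then y j else ballv j 0)" for j
    have "child (w j) (w (j + 1))" for j
      using child[of j] childI[of j 0] y01 by (cases "j = - 1") (auto simp: w_def)
    then show ?thesis
      using child_sequence_below[of w m 0 0 n] ym n \<open>k = 0\<close> by (simp add: w_def m_def)
  qed
  then show ?thesis using M by (metis y_def add_0_right pgl_act_eq_iff)
qed

lemma fixes_path_of_fixes_ends:
  assumes complete: "complete_dval v" and x: "dpath v x" and g: "aut v g"
    and fix01: "g (x 0) = x 0" "g (x 1) = x 1" and fwd: "fixes_end_fwd g x" and bwd: "fixes_end_bwd g x"
  shows "g (x n) = x n"
proof (cases "0 \<le> n")
  case True
  then show ?thesis using fixes_ray_of_fixes_end[OF complete x g fix01 fwd] by blast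
next
  case False
  \<comment> \<open>This reversal exchanges \<open>x 0\<close> and \<open>x 1\<close> and makes the
    backward end the forward one. Its centre accounts for the bound \<open>N + 1\<close> in place of
    \<open>N\<close>.\<close>
  define z where "z m = x (1 - m)" for m
  obtain k N where kN: "\<And>n. N \<le> n \<Longrightarrow> g (x (- n)) = x (- (n + k))"
    using bwd by (auto simp: fixes_end_bwd_def)
  have "g (z m) = z (m + k)" if "N + 1 \<le> m" for m
    using kN[of "m - 1"] that by (simp add: z_def algebra_simps)
  then have "fixes_end_fwd g z" unfolding fixes_end_fwd_def by blast
  moreover have "dpath v z" unfolding z_def by (rule dpath_reverse[OF x])
  moreover have "g (z 0) = z 0" "g (z 1) = z 1" using fix01 by (simp_all add: z_def)
  moreover have "0 \<le> 1 - n" using False by simp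
  ultimately have "g (z (1 - n)) = z (1 - n)"
    using fixes_ray_of_fixes_end[OF complete _ g, of z "1 - n"] by blast
  then show ?thesis by (simp add: z_def)
qed

section \<open>The factorization\<close>

lemma Ihat_factorization:
  assumes complete: "complete_dval v" and x: "dpath v x" and g: "g \<in> Ihat v e x"
  shows "g \<in> setprod (Ihat v e x \<inter> Bhat v e x) (Ihat v e x \<inter> Bhat' v e x)"
proof -
  have gG: "g \<in> Ghat v e" and g01: "g (x 0) = x 0" "g (x 1) = x 1" using g by (auto simp: Ihat_def)
  then have ag: "aut v g" by (simp add: Ghat_def)
  then have inj: "inj_on g (vertices v)" and surj: "g ` vertices v = vertices v"
    by (auto simp: aut_def bij_betw_def)
  \<comment> \<open>The preimage of the path under \<open>g\<close>, taken inside
    \<open>vertices v\<close>, where \<open>aut\<close> states bijectivity. It shares the vertices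
    at 0 and 1 with \<open>x\<close>.\<close>
  define y where "y n = inv_into (vertices v) g (x n)" for n
  have yV: "y n \<in> vertices v" and gy: "g (y n) = x n" for n
    using surj dpath_vertex[OF x, of n] by (auto simp: y_def inv_into_into f_inv_into_f)
  have "adj v (y n) (y (n + 1))" for n
    using aut_adj_iff[OF ag yV yV, of n "n + 1"] x by (simp add: gy dpath_def)
  moreover have "y (n - 1) \<noteq> y (n + 1)" for n using x gy unfolding dpath_def by metis
  ultimately have y: "dpath v y" by (simp add: dpath_def)
  have "y 0 = x 0" "y 1 = x 1"
    using inj dpath_vertex[OF x] yV gy g01 by (metis inj_on_eq_iff)+
  then obtain U where U: "mat_inv U" "\<And>n. 0 \<le> n \<Longrightarrow> pgl_act v U (y n) = x n"
    "\<And>n. n \<le> 1 \<Longrightarrow> pgl_act v U (x n) = x n"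
    using pgl_act_align_ray[OF complete x y] by metis
  define b where "b = g \<circ> pgl_act v (mat_inverse U)"
  have "b (x n) = x n" if "0 \<le> n" for n
    unfolding b_def comp_apply using U(2)[OF that] gy pgl_act_inverse(2)[OF U(1), of v "y n"] by simp
  moreover have "b \<in> Ghat v e"
    unfolding b_def by (intro Ghat_comp gG pgl_act_in_Ghat mat_inv_inverse U)
  moreover have "fixes_end_fwd b x"
    unfolding fixes_end_fwd_def using calculation(1) by (intro exI[of _ 0]) simp
  ultimately have b: "b \<in> Ihat v e x \<inter> Bhat v e x" by (simp add: Ihat_def Bhat_def)
  \<comment> \<open>\<open>U\<close> fixes \<open>x n\<close> for \<open>n \<le> 1\<close>: this
    covers the backward ray, with shift 0, and the edge \<open>x 0\<close>, \<open>x 1\<close>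
    required by \<open>Ihat\<close>.\<close>
  have "fixes_end_bwd (pgl_act v U) x"
    unfolding fixes_end_bwd_def using U(3) by (intro exI[of _ 0]) simp
  then have b': "pgl_act v U \<in> Ihat v e x \<inter> Bhat' v e x"
    using U(3) pgl_act_in_Ghat[OF U(1)] by (simp add: Ihat_def Bhat'_def)
  have "g = b \<circ> pgl_act v U" by (auto simp: b_def pgl_act_inverse[OF U(1)])
  then show ?thesis using b b' unfolding setprod_def by blast
qed

end

theorem mainTheorem13:
  fixes v :: "'a::field \<Rightarrow> int" and e :: nat and x :: "int \<Rightarrow> 'a vertex"
  assumes "nonarch_local_field v" and "e \<ge> 1" and "dpath v x"
  shows "Ihat v e x = setprod (Ihat v e x \<inter> Bhat v e x) (Ihat v e x \<inter> Bhat' v e x) \<and>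
         (Ihat v e x \<inter> Bhat v e x) \<inter> (Ihat v e x \<inter> Bhat' v e x) = Hhat v e x"
proof -
  interpret valued_field v
    using assms(1) by unfold_locales (simp add: nonarch_local_field_def)
  have complete: "complete_dval v" using assms(1) by (simp add: nonarch_local_field_def)
  have "setprod (Ihat v e x \<inter> Bhat v e x) (Ihat v e x \<inter> Bhat' v e x) \<subseteq> Ihat v e x"
    using Ghat_comp by (auto simp: setprod_def Ihat_def)
  moreover have "Ihat v e x \<subseteq> setprod (Ihat v e x \<inter> Bhat v e x) (Ihat v e x \<inter> Bhat' v e x)"
    using Ihat_factorization[OF complete assms(3)] by blast
  \<comment> \<open>Fixing both ends and the edge \<open>x 0\<close>, \<open>x 1\<close> forces the
    whole path to be fixed; index 0 witnesses membership in \<open>Nhat\<close>.\<close>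
  moreover have "(Ihat v e x \<inter> Bhat v e x) \<inter> (Ihat v e x \<inter> Bhat' v e x) \<subseteq> Hhat v e x"
    using fixes_path_of_fixes_ends[OF complete assms(3)]
    by (auto simp: Hhat_def Nhat_def Bhat_def Bhat'_def Ihat_def Ghat_def)
  moreover have "fixes_end_bwd g x" if "\<forall>k. g (x k) = x k" for g
    unfolding fixes_end_bwd_def using that by (intro exI[of _ 0]) simp
  then have "Hhat v e x \<subseteq> (Ihat v e x \<inter> Bhat v e x) \<inter> (Ihat v e x \<inter> Bhat' v e x)"
    by (auto simp: Hhat_def Nhat_def Bhat_def Bhat'_def Ihat_def)
  ultimately show ?thesis by blast
qed

end
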